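(* Let $p$ be a prime, $q=p^e$ with $e\ge 1$, and let $n\ge 0$ be an integer. Assume that $E_n(1,x)$ is a permutation polynomial of $\mathbb{F}_q$. If $p=2$, then $3\mid (n+1)$. If $p$ is an odd prime, then $n\not\equiv 0,1 \pmod 6$.
   Context: $\mathbb{F}_q$ is the finite field with $q$ elements. For an integer $n\ge 0$, the reversed Dickson polynomial of the second kind (with parameter $1$) is $$E_n(1,x):=\sum_{i=0}^{\lfloor n/2\rfloor}\binom{n-i}{i}(-x)^i\in\mathbb{F}_q[x],$$ where the binomial coefficients are interpreted in $\mathbb{F}_q$. A polynomial in $\mathbb{F}_q[x]$ is a permutation polynomial (PP) of $\mathbb{F}_q$ if the map it induces on $\mathbb{F}_q$ is a bijection. *)

theory Defs
  imports "HOL-Library.Cardinality" "HOL-Computational_Algebra.Polynomial"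
    "HOL-Computational_Algebra.Primes" "HOL-Number_Theory.Cong"
begin

(* E_n(1,x), with the binomial coefficients mapped into the coefficient ring. *)
definition rev_dickson2 :: "nat \<Rightarrow> 'a::comm_ring_1 poly" where
  "rev_dickson2 n =
     (\<Sum>i = 0..n div 2. smult (of_nat ((n - i) choose i)) ((- [:0, 1:]) ^ i))"

(* The finite field is the whole type 'a. *)
definition permutation_poly :: "'a::{finite,field} poly \<Rightarrow> bool" where
  "permutation_poly f \<longleftrightarrow> bij (poly f)"

end

theory Submission
  imports Defs "HOL-Number_Theory.Residues"
begin

text \<open>
  A permutation polynomial separates \<open>0\<close> and \<open>1\<close>, so it suffices to know the
  values of \<open>E\<^sub>n(1,x)\<close> at these two points.  The constant term gives
  \<open>E\<^sub>n(1,0) = 1\<close>.  Pascal's rule gives the second-order recurrence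
  \<open>E\<^sub>n\<^sub>+\<^sub>2(1,x) = E\<^sub>n\<^sub>+\<^sub>1(1,x) - x E\<^sub>n(1,x)\<close> (lemma \<open>poly_rev_dickson2_rec\<close>),
  whose characteristic polynomial at \<open>x = 1\<close> is the sixth cyclotomic polynomial
  \<open>T\<^sup>2 - T + 1\<close>; hence the values \<open>E\<^sub>n(1,1)\<close> run through
  \<open>1, 1, 0, -1, -1, 0\<close> with period \<open>6\<close> (lemma \<open>poly_rev_dickson2_1\<close>).

  If \<open>n\<close> is \<open>0\<close> or \<open>1\<close> modulo \<open>6\<close>, the values at \<open>0\<close> and \<open>1\<close> coincide.
  In characteristic \<open>2\<close> the signs disappear and the sequence becomes
  \<open>1, 1, 0\<close> with period \<open>3\<close>, so the values at \<open>0\<close> and \<open>1\<close> coincide unless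
  \<open>n\<close> is \<open>2\<close> modulo \<open>3\<close>.
\<close>

text \<open>
  The terms with index above \<open>n div 2\<close> have a vanishing binomial coefficient, so the
  range of summation can be chosen to suit: the recurrence below compares sums for
  different \<open>n\<close>.
\<close>
lemma poly_rev_dickson2_extend:
  assumes "n div 2 \<le> N"
  shows "poly (rev_dickson2 n) x = (\<Sum>i\<le>N. of_nat ((n - i) choose i) * (- x) ^ i)"
proof -
  have "poly (rev_dickson2 n) x = (\<Sum>i = 0..n div 2. of_nat ((n - i) choose i) * (- x) ^ i)"
    by (simp add: rev_dickson2_def poly_sum poly_power)
  also have "\<dots> = (\<Sum>i\<le>N. of_nat ((n - i) choose i) * (- x) ^ i)"
    using assms by (intro sum.mono_neutral_left) (auto simp: binomial_eq_0)
  finally show ?thesis .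
qed

lemma poly_rev_dickson2_rec:
  "poly (rev_dickson2 (Suc (Suc n))) x =
     poly (rev_dickson2 (Suc n)) x - x * poly (rev_dickson2 n) x"
proof -
  define y where "y = - x"
  have "poly (rev_dickson2 (Suc (Suc n))) x =
          (\<Sum>i\<le>Suc n. of_nat ((Suc (Suc n) - i) choose i) * y ^ i)"
    unfolding y_def by (rule poly_rev_dickson2_extend) simp
  also have "\<dots> = 1 + (\<Sum>j\<le>n. of_nat ((Suc n - j) choose Suc j) * y ^ Suc j)"
    by (subst sum.atMost_Suc_shift) simp
  also have "(\<Sum>j\<le>n. of_nat ((Suc n - j) choose Suc j) * y ^ Suc j) =
               (\<Sum>j\<le>n. of_nat ((n - j) choose Suc j) * y ^ Suc j) +
               y * (\<Sum>j\<le>n. of_nat ((n - j) choose j) * y ^ j)"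
    unfolding sum_distrib_left sum.distrib [symmetric]
    by (intro sum.cong) (auto simp: Suc_diff_le algebra_simps)
  also have "1 + ((\<Sum>j\<le>n. of_nat ((n - j) choose Suc j) * y ^ Suc j) +
                  y * (\<Sum>j\<le>n. of_nat ((n - j) choose j) * y ^ j)) =
             (1 + (\<Sum>j\<le>n. of_nat ((n - j) choose Suc j) * y ^ Suc j)) +
             y * poly (rev_dickson2 n) x"
    by (simp add: poly_rev_dickson2_extend [of n n] y_def)
  also have "1 + (\<Sum>j\<le>n. of_nat ((n - j) choose Suc j) * y ^ Suc j) =
             (\<Sum>i\<le>Suc n. of_nat ((Suc n - i) choose i) * y ^ i)"
    by (subst sum.atMost_Suc_shift) simp
  also have "\<dots> = poly (rev_dickson2 (Suc n)) x"
    unfolding y_def by (rule poly_rev_dickson2_extend [symmetric]) simp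
  finally show ?thesis
    by (simp add: y_def)
qed

lemma poly_rev_dickson2_0: "poly (rev_dickson2 n) 0 = 1"
  by (simp add: poly_rev_dickson2_extend [OF order.refl] power_0_left if_distrib cong: if_cong)

text \<open>
  Each root of \<open>T\<^sup>2 - T + 1\<close> has cube \<open>-1\<close>, so three steps of the recurrence at
  \<open>x = 1\<close> only change the sign.
\<close>
lemma poly_rev_dickson2_1_add_3:
  "poly (rev_dickson2 (n + 3)) 1 = - poly (rev_dickson2 n) 1"
  by (simp add: numeral_3_eq_3 poly_rev_dickson2_rec)

lemma poly_rev_dickson2_1:
  "poly (rev_dickson2 n :: 'a::comm_ring_1 poly) 1 =
     (if n mod 3 = 2 then 0 else (- 1) ^ (n div 3))"
proof -
  have base: "poly (rev_dickson2 r :: 'a poly) 1 = (if r = 2 then 0 else 1)" if "r < 3" for r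
  proof -
    have "poly (rev_dickson2 0 :: 'a poly) 1 = 1" "poly (rev_dickson2 1 :: 'a poly) 1 = 1"
      by (simp_all add: rev_dickson2_def)
    moreover from this have "poly (rev_dickson2 2 :: 'a poly) 1 = 0"
      by (simp add: numeral_2_eq_2 poly_rev_dickson2_rec)
    moreover have "r = 0 \<or> r = 1 \<or> r = 2"
      using that by linarith
    ultimately show ?thesis
      by auto
  qed
  have step: "poly (rev_dickson2 (r + 3 * k) :: 'a poly) 1 = (- 1) ^ k * poly (rev_dickson2 r) 1"
    for r k
  proof (induction k)
    case (Suc k)
    then show ?case
      using poly_rev_dickson2_1_add_3 [of "r + 3 * k", where 'a = 'a] by (simp add: add_ac)
  qed simp
  show ?thesis
    using step [of "n mod 3" "n div 3"] base [of "n mod 3"] by simp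
qed

lemma minus_one_eq_one_if_CARD_power_2:
  assumes "CARD('a::{finite,field}) = 2 ^ e"
  shows "(- 1 :: 'a) = 1"
proof -
  have "of_nat (2 ^ e) = (0 :: 'a)"
    unfolding assms [symmetric] of_nat_eq_0_iff_char_dvd by (rule CHAR_dvd_CARD)
  then have "(2 :: 'a) = 0"
    by simp
  then have "(1 :: 'a) + 1 = 0"
    by simp
  then show ?thesis
    by (rule minus_unique)
qed

theorem theorem3p1:
  fixes p e n :: nat
  assumes "prime p"
    and "e \<ge> 1"
    and "CARD('a::{finite,field}) = p ^ e"
    and "permutation_poly (rev_dickson2 n :: 'a poly)"
  shows "(p = 2 \<longrightarrow> 3 dvd (n + 1)) \<and>
         (odd p \<longrightarrow> \<not> [n = 0] (mod 6) \<and> \<not> [n = 1] (mod 6))"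
proof -
  have "poly (rev_dickson2 n :: 'a poly) 1 \<noteq> poly (rev_dickson2 n) 0"
    using assms(4) by (simp add: permutation_poly_def bij_def inj_eq)
  then have not_1: "poly (rev_dickson2 n :: 'a poly) 1 \<noteq> 1"
    by (simp add: poly_rev_dickson2_0)
  have "3 dvd (n + 1)" if "p = 2"
  proof -
    have "(- 1 :: 'a) = 1"
      using assms(3) that by (intro minus_one_eq_one_if_CARD_power_2) simp
    then have "(- 1 :: 'a) ^ (n div 3) = 1"
      by (simp only: power_one)
    then have "n mod 3 = 2"
      using not_1 by (simp add: poly_rev_dickson2_1 split: if_splits)
    then show ?thesis
      by presburger
  qed
  moreover have "\<not> [n = r] (mod 6)" if "r = 0 \<or> r = 1" for r
  proof
    assume "[n = r] (mod 6)"
    then have "n mod 6 = 0 \<or> n mod 6 = 1"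
      using that by (auto simp: cong_def)
    then have "n mod 3 \<noteq> 2" "even (n div 3)"
      by presburger+
    then show False
      using not_1 by (simp add: poly_rev_dickson2_1)
  qed
  ultimately show ?thesis
    by blast
qed

end
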